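(* Let $\mathbf{X}=(X_1,\dots,X_n)$ and $\mathbf{Y}=(Y_1,\dots,Y_n)$ be vectors of $n$ independent Bernoulli random variables with success probabilities $p_1,\dots,p_n$ and $q_1,\dots,q_n$, respectively, where $0<p_i\le q_i<1$ for all $i\in\{1,\dots,n\}$. Then for all $k\in\{0,1,\dots,n\}$, $$\mathcal{L}\Bigl(\sum_{i=1}^nX_i\Bigm|\sum_{i=1}^nX_i\ge k\Bigr)\preceq\mathcal{L}\Bigl(\sum_{i=1}^nY_i\Bigm|\sum_{i=1}^nY_i\ge k\Bigr).$$
   Context: $\mathcal{L}(Z\mid A)$ denotes the conditional law of $Z$ given the event $A$. For laws $\mu,\nu$ on $\mathbb{R}^d$, $\mu\preceq\nu$ (stochastic domination) means that there exist random vectors $\mathbf{U}$ with law $\mu$ and $\mathbf{V}$ with law $\nu$ on a common probability space such that $\mathbf{U}\le\mathbf{V}$ componentwise with probability $1$. *)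

theory Defs
  imports "HOL-Probability.Probability"
begin

(* As usual, this is only meaningful if the event A has positive probability. *)
definition cond_law :: "'a measure \<Rightarrow> ('a \<Rightarrow> 'b::topological_space) \<Rightarrow> 'a set \<Rightarrow> 'b measure"
  where "cond_law M Z A = distr (uniform_measure M A) borel Z"

(* The order on an ordered Euclidean space is the componentwise one.
   HOL cannot quantify over the type of the sample space; fixing it to be 'a * 'a loses
   nothing, since U and V on any probability space can be replaced by the two
   coordinate projections under the joint law of (U, V). *)
definition stoch_dom :: "'a::ordered_euclidean_space measure \<Rightarrow> 'a measure \<Rightarrow> bool"
    (infix "\<preceq>" 50)
  where "\<mu> \<preceq> \<nu> \<longleftrightarrow>
    (\<exists>(P :: ('a \<times> 'a) measure) U V.
       prob_space P \<and> U \<in> borel_measurable P \<and> V \<in> borel_measurable P \<and>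
       distr P borel U = \<mu> \<and> distr P borel V = \<nu> \<and>
       (AE \<omega> in P. U \<omega> \<le> V \<omega>))"

(* bernoulli_pmf is a law on bool, transported to {0, 1} by of_bool; it clamps p to [0, 1],
   so p is meant to be in that range. *)
definition bernoulli_rv :: "'a measure \<Rightarrow> ('a \<Rightarrow> real) \<Rightarrow> real \<Rightarrow> bool"
  where "bernoulli_rv M Z p \<longleftrightarrow>
    Z \<in> borel_measurable M \<and>
    distr M borel Z = distr (measure_pmf (bernoulli_pmf p)) borel of_bool"

end

theory Submission
  imports Defs
begin

text \<open>Write T(j) for the probability that a sum of independent Bernoulli variables is at least j.
  Adding a variable with success probability p replaces T by p T(j - 1) + (1 - p) T(j). This operation
  preserves log-concavity of T, and for log-concave T the ratio T(j) / T(k) with k \<le> j grows with p;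
  so, one variable at a time, the ratios for \<open>\<Sum>Y\<^sub>i\<close> dominate those for \<open>\<Sum>X\<^sub>i\<close>. These ratios
  are the tails of the conditional laws, and ordered tails give an ordered coupling by
  taking quantile functions of a common uniform variable.\<close>

section \<open>Tail sequences and their order\<close>

definition bernoulli_step :: "real \<Rightarrow> (int \<Rightarrow> real) \<Rightarrow> int \<Rightarrow> real"
  where "bernoulli_step p T j = p * T (j - 1) + (1 - p) * T j"

text \<open>Indexing by all of \<open>int\<close> keeps the shift \<open>j - 1\<close> free of a
  boundary case: the sequence is constantly 1 on \<open>j \<le> 0\<close>.\<close>

primrec bernoulli_tail :: "(nat \<Rightarrow> real) \<Rightarrow> nat \<Rightarrow> int \<Rightarrow> real"
  where "bernoulli_tail p 0 = (\<lambda>j. of_bool (j \<le> 0))"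
  | "bernoulli_tail p (Suc n) = bernoulli_step (p (Suc n)) (bernoulli_tail p n)"

text \<open>Unlike \<open>T (a - 1) * T (a + 1) \<le> (T a)\<^sup>2\<close>, this form also excludes internal zeros.\<close>

definition log_concave_seq :: "(int \<Rightarrow> real) \<Rightarrow> bool"
  where "log_concave_seq T \<longleftrightarrow> (\<forall>a b. a \<le> b \<longrightarrow> T (a - 1) * T b \<le> T a * T (b - 1))"

text \<open>This is \<open>A j / A k \<le> B j / B k\<close> cross-multiplied for nonnegative
  sequences, so that zeros of the tails beyond the number of variables need no division.\<close>

definition ratio_le :: "(int \<Rightarrow> real) \<Rightarrow> (int \<Rightarrow> real) \<Rightarrow> bool"
  where "ratio_le A B \<longleftrightarrow> (\<forall>j k. k \<le> j \<longrightarrow> A j * B k \<le> B j * A k)"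

section \<open>Log-concavity and ratio order under a Bernoulli step\<close>

lemma log_concave_seqD: "log_concave_seq T \<Longrightarrow> a \<le> b \<Longrightarrow> T (a - 1) * T b \<le> T a * T (b - 1)"
  by (simp add: log_concave_seq_def)

lemma ratio_leD: "ratio_le A B \<Longrightarrow> k \<le> j \<Longrightarrow> A j * B k \<le> B j * A k"
  by (simp add: ratio_le_def)

text \<open>Sort the expanded difference by \<open>p\<^sup>2\<close>, \<open>(1 - p)\<^sup>2\<close>
  and \<open>p * (1 - p)\<close>. The first two coefficients are instances of log-concavity. In the
  third, \<open>T (a - 1) * T (b - 1)\<close> cancels, and what remains chains two instances through
  that same product. The second link needs \<open>a \<le> b - 1\<close>, so \<open>a = b\<close>, a
  case of equality, is split off.\<close>

lemma log_concave_seq_bernoulli_step: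
  assumes T: "log_concave_seq T" and p: "0 \<le> p" "p \<le> 1"
  shows "log_concave_seq (bernoulli_step p T)"
  unfolding log_concave_seq_def
proof (intro allI impI)
  fix a b :: int
  assume "a \<le> b"
  show "bernoulli_step p T (a - 1) * bernoulli_step p T b
      \<le> bernoulli_step p T a * bernoulli_step p T (b - 1)"
  proof (cases "a = b")
    case False
    with \<open>a \<le> b\<close> have ab: "a \<le> b - 1" by simp
    have 1: "T (a - 2) * T (b - 1) \<le> T (a - 1) * T (b - 2)"
      using log_concave_seqD[OF T, of "a - 1" "b - 1"] ab by simp
    have 2: "T (a - 1) * T b \<le> T a * T (b - 1)"
      using log_concave_seqD[OF T \<open>a \<le> b\<close>] .
    have "T (a - 2) * T b \<le> T (a - 1) * T (b - 1)"
      using log_concave_seqD[OF T, of "a - 1" b] ab by simp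
    also have "\<dots> \<le> T a * T (b - 2)"
      using log_concave_seqD[OF T ab] by simp
    finally have 3: "T (a - 2) * T b \<le> T a * T (b - 2)" .
    have "0 \<le> p\<^sup>2 * (T (a - 1) * T (b - 2) - T (a - 2) * T (b - 1))
        + (1 - p)\<^sup>2 * (T a * T (b - 1) - T (a - 1) * T b)
        + p * (1 - p) * (T a * T (b - 2) - T (a - 2) * T b)"
      using 1 2 3 p by (intro add_nonneg_nonneg mult_nonneg_nonneg) simp_all
    also have "\<dots> = bernoulli_step p T a * bernoulli_step p T (b - 1)
        - bernoulli_step p T (a - 1) * bernoulli_step p T b"
      by (simp add: bernoulli_step_def power2_eq_square algebra_simps)
    finally show ?thesis by simp
  qed (simp add: mult.commute)
qed

text \<open>The same expansion works here, with a mixed coefficient that is the sum of the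
  comparisons at \<open>(j - 1, k)\<close> and \<open>(j, k - 1)\<close>. The former requires
  \<open>k \<le> j - 1\<close>, hence the separate case \<open>k = j\<close>.\<close>

lemma ratio_le_bernoulli_step:
  assumes AB: "ratio_le A B" and p: "0 \<le> p" "p \<le> 1"
  shows "ratio_le (bernoulli_step p A) (bernoulli_step p B)"
  unfolding ratio_le_def
proof (intro allI impI)
  fix j k :: int
  assume "k \<le> j"
  show "bernoulli_step p A j * bernoulli_step p B k \<le> bernoulli_step p B j * bernoulli_step p A k"
  proof (cases "k = j")
    case False
    with \<open>k \<le> j\<close> have kj: "k \<le> j - 1" by simp
    have "0 \<le> p\<^sup>2 * (B (j - 1) * A (k - 1) - A (j - 1) * B (k - 1))
        + (1 - p)\<^sup>2 * (B j * A k - A j * B k)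
        + p * (1 - p) * ((B (j - 1) * A k - A (j - 1) * B k) + (B j * A (k - 1) - A j * B (k - 1)))"
      using ratio_leD[OF AB, of "k - 1" "j - 1"] ratio_leD[OF AB \<open>k \<le> j\<close>]
        ratio_leD[OF AB kj] ratio_leD[OF AB, of "k - 1" j] p kj
      by (intro add_nonneg_nonneg mult_nonneg_nonneg) simp_all
    also have "\<dots> = bernoulli_step p B j * bernoulli_step p A k
        - bernoulli_step p A j * bernoulli_step p B k"
      by (simp add: bernoulli_step_def power2_eq_square algebra_simps)
    finally show ?thesis by simp
  qed simp
qed

text \<open>The difference of the two sides factors into \<open>q - p\<close> and exactly the
  expression that log-concavity makes nonnegative.\<close>

lemma ratio_le_bernoulli_step_param:
  assumes T: "log_concave_seq T" and pq: "p \<le> q"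
  shows "ratio_le (bernoulli_step p T) (bernoulli_step q T)"
  unfolding ratio_le_def
proof (intro allI impI)
  fix j k :: int
  assume "k \<le> j"
  then have "0 \<le> (q - p) * (T (j - 1) * T k - T j * T (k - 1))"
    using log_concave_seqD[OF T \<open>k \<le> j\<close>] pq by (simp add: mult.commute)
  also have "\<dots> = bernoulli_step q T j * bernoulli_step p T k
      - bernoulli_step p T j * bernoulli_step q T k"
    by (simp add: bernoulli_step_def algebra_simps)
  finally show "bernoulli_step p T j * bernoulli_step q T k \<le> bernoulli_step q T j * bernoulli_step p T k"
    by simp
qed

text \<open>Transitivity follows by cancelling \<open>B k\<close>. The cross-multiplied relation
  holds trivially to and from the zero sequence, so \<open>zero\<close> has to cover the case where
  \<open>B k\<close> cannot be cancelled.\<close>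

lemma ratio_le_trans:
  assumes AB: "ratio_le A B" and BC: "ratio_le B C"
    and nonneg: "\<And>j. 0 \<le> A j" "\<And>j. 0 \<le> B j" "\<And>j. 0 \<le> C j"
    and zero: "\<And>j k. k \<le> j \<Longrightarrow> B k = 0 \<Longrightarrow> A j = 0"
  shows "ratio_le A C"
  unfolding ratio_le_def
proof (intro allI impI)
  fix j k :: int
  assume kj: "k \<le> j"
  show "A j * C k \<le> C j * A k"
  proof (cases "B k = 0")
    case True
    then show ?thesis using zero[OF kj] nonneg by simp
  next
    case False
    then have pos: "0 < B k" using nonneg(2)[of k] by simp
    have "(A j * C k) * B k \<le> (B j * A k) * C k"
      using mult_right_mono[OF ratio_leD[OF AB kj] nonneg(3)[of k]] by (simp add: mult_ac)
    also have "\<dots> \<le> (C j * A k) * B k"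
      using mult_right_mono[OF ratio_leD[OF BC kj] nonneg(1)[of k]] by (simp add: mult_ac)
    finally show ?thesis using pos by simp
  qed
qed

section \<open>Tails of Bernoulli sums as sequences\<close>

lemma bernoulli_tail_nonneg:
  assumes "\<And>i. i \<in> {1..n} \<Longrightarrow> 0 \<le> p i \<and> p i \<le> 1"
  shows "0 \<le> bernoulli_tail p n j"
  using assms by (induction n arbitrary: j) (simp_all add: bernoulli_step_def)

lemma bernoulli_tail_pos:
  assumes "\<And>i. i \<in> {1..n} \<Longrightarrow> 0 < p i \<and> p i \<le> 1" and "j \<le> int n"
  shows "0 < bernoulli_tail p n j"
  using assms
proof (induction n arbitrary: j)
  case (Suc n)
  \<comment> \<open>From \<open>j \<le> Suc n\<close> only \<open>j - 1 \<le> n\<close> follows, so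
    this summand carries the strictness; the other one vanishes at \<open>j = n + 1\<close>.\<close>
  have "0 < bernoulli_tail p n (j - 1)" using Suc by simp
  moreover have "0 \<le> bernoulli_tail p n j"
    using Suc.prems by (intro bernoulli_tail_nonneg) (simp add: less_imp_le)
  moreover have "0 < p (Suc n)" "p (Suc n) \<le> 1" using Suc.prems by simp_all
  ultimately show ?case by (simp add: bernoulli_step_def add_pos_nonneg)
qed simp

lemma bernoulli_tail_eq_0: "int n < j \<Longrightarrow> bernoulli_tail p n j = 0"
  by (induction n arbitrary: j) (simp_all add: bernoulli_step_def)

lemma log_concave_bernoulli_tail:
  assumes "\<And>i. i \<in> {1..n} \<Longrightarrow> 0 \<le> p i \<and> p i \<le> 1"
  shows "log_concave_seq (bernoulli_tail p n)"
  using assms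
proof (induction n)
  case 0
  show ?case by (auto simp: log_concave_seq_def)
next
  case (Suc n)
  then show ?case by (simp add: log_concave_seq_bernoulli_step)
qed

text \<open>Each induction step is made in two moves: the first \<open>n\<close> parameters change
  under a common last step, then the last parameter changes over a common log-concave tail.\<close>

lemma ratio_le_bernoulli_tail:
  assumes "\<And>i. i \<in> {1..n} \<Longrightarrow> 0 < p i \<and> p i \<le> q i \<and> q i \<le> 1"
  shows "ratio_le (bernoulli_tail p n) (bernoulli_tail q n)"
  using assms
proof (induction n)
  case 0
  show ?case by (simp add: ratio_le_def)
next
  case (Suc n)
  \<comment> \<open>The tail for the parameters \<open>q\<^sub>1, \<dots>, q\<^sub>n, p\<^sub>n\<^sub>+\<^sub>1\<close> lies between the two.\<close>
  define r where "r = q(Suc n := p (Suc n))"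
  have pq: "0 < p i" "p i \<le> q i" "q i \<le> 1" if "i \<in> {1..Suc n}" for i
    using Suc.prems[OF that] by simp_all
  have p1: "p i \<le> 1" and q0: "0 < q i" if "i \<in> {1..Suc n}" for i
    using pq[OF that] by simp_all
  have bounds: "0 < r i \<and> r i \<le> 1" if "i \<in> {1..Suc n}" for i
    using pq[OF that] q0[OF that] by (auto simp: r_def)
  \<comment> \<open>A tail of length \<open>m\<close> depends on the first \<open>m\<close>
    parameters only, so the update at \<open>Suc n\<close> leaves \<open>bernoulli_tail q n\<close>
    intact.\<close>
  have cong: "bernoulli_tail f m = bernoulli_tail g m" if "\<And>i. i \<in> {1..m} \<Longrightarrow> f i = g i" for f g m
    using that by (induction m) simp_all
  have r: "bernoulli_tail r (Suc n) = bernoulli_step (p (Suc n)) (bernoulli_tail q n)"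
    using cong[of n r q] by (simp add: r_def)
  have last: "Suc n \<in> {1..Suc n}" by simp
  have "ratio_le (bernoulli_tail p (Suc n)) (bernoulli_tail r (Suc n))"
    unfolding r bernoulli_tail.simps(2)[of p] using Suc pq(1)[OF last] p1[OF last]
    by (intro ratio_le_bernoulli_step) (simp_all add: less_imp_le)
  moreover have "ratio_le (bernoulli_tail r (Suc n)) (bernoulli_tail q (Suc n))"
    unfolding r bernoulli_tail.simps(2)[of q]
    using pq(2)[OF last] q0 pq(3)
    by (intro ratio_le_bernoulli_step_param log_concave_bernoulli_tail) (simp_all add: less_imp_le)
  ultimately show ?case
  proof (rule ratio_le_trans)
    show "0 \<le> bernoulli_tail p (Suc n) j" "0 \<le> bernoulli_tail q (Suc n) j"
      "0 \<le> bernoulli_tail r (Suc n) j" for j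
      by (rule bernoulli_tail_nonneg; use pq p1 q0 bounds in \<open>simp add: less_imp_le\<close>)+
    \<comment> \<open>All parameters of \<open>r\<close> are positive, so a zero at \<open>k\<close>
      forces \<open>k > n + 1\<close>; then \<open>j\<close> also exceeds the number of
      variables.\<close>
    show "bernoulli_tail p (Suc n) j = 0"
      if "k \<le> j" "bernoulli_tail r (Suc n) k = 0" for j k
    proof (rule bernoulli_tail_eq_0)
      show "int (Suc n) < j"
        using bernoulli_tail_pos[of "Suc n" r k] bounds that by force
    qed
  qed
qed

section \<open>From random variables to tail sequences\<close>

lemma bernoulli_rv_AE:
  assumes "prob_space M" and Z: "bernoulli_rv M Z p"
  shows "AE \<omega> in M. Z \<omega> \<in> {0, 1}"
proof -
  have [measurable]: "Z \<in> borel_measurable M" using Z by (simp add: bernoulli_rv_def)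
  have "AE x in distr (measure_pmf (bernoulli_pmf p)) borel of_bool. x \<in> {0, 1::real}"
    by (subst AE_distr_iff) auto
  moreover have "distr M borel Z = distr (measure_pmf (bernoulli_pmf p)) borel of_bool"
    using Z by (simp add: bernoulli_rv_def)
  ultimately have "AE x in distr M borel Z. x \<in> {0, 1}" by (simp only:)
  then show ?thesis by (subst (asm) AE_distr_iff) auto
qed

lemma bernoulli_rv_prob:
  assumes "prob_space M" and Z: "bernoulli_rv M Z p" and p: "0 \<le> p" "p \<le> 1"
  shows "measure M {\<omega> \<in> space M. Z \<omega> = 1} = p" "measure M {\<omega> \<in> space M. Z \<omega> = 0} = 1 - p"
proof -
  have [measurable]: "Z \<in> borel_measurable M" using Z by (simp add: bernoulli_rv_def)
  have eq: "measure M {\<omega> \<in> space M. Z \<omega> = x}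
      = measure (measure_pmf (bernoulli_pmf p)) {b. of_bool b = x}" for x
  proof -
    have "measure (distr M borel Z) {x} = measure (distr (measure_pmf (bernoulli_pmf p)) borel of_bool) {x}"
      using Z by (simp add: bernoulli_rv_def)
    then show ?thesis
      by (simp add: measure_distr vimage_def Int_def conj_commute)
  qed
  have "{b. of_bool b = (1::real)} = {True}" "{b. of_bool b = (0::real)} = {False}" by auto
  with eq[of 1] eq[of 0] p show "measure M {\<omega> \<in> space M. Z \<omega> = 1} = p"
    "measure M {\<omega> \<in> space M. Z \<omega> = 0} = 1 - p"
    by (simp_all add: measure_pmf_single)
qed

text \<open>Integrality allows a real threshold for the sum to be replaced by an integer
  one.\<close>

lemma bernoulli_sum_AE_Ints:
  fixes X :: "nat \<Rightarrow> 'a \<Rightarrow> real"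
  assumes "prob_space M" and "\<And>i. i \<in> {1..n} \<Longrightarrow> bernoulli_rv M (X i) (p i)"
  shows "AE \<omega> in M. (\<Sum>i=1..n. X i \<omega>) \<in> \<int>"
proof -
  have "AE \<omega> in M. \<forall>i\<in>{1..n}. X i \<omega> \<in> {0, 1}"
    using assms bernoulli_rv_AE by (intro AE_finite_allI) blast+
  then show ?thesis
    by eventually_elim (rule Ints_sum, force)
qed

text \<open>Splitting on the value of the last variable, which is independent of the sum of the
  others, reproduces the recursion of \<open>bernoulli_tail\<close>.\<close>

lemma prob_bernoulli_sum_ge:
  fixes X :: "nat \<Rightarrow> 'a \<Rightarrow> real"
  assumes "prob_space M" and "prob_space.indep_vars M (\<lambda>_. borel) X {1..n}"
    and "\<And>i. i \<in> {1..n} \<Longrightarrow> bernoulli_rv M (X i) (p i)"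
    and "\<And>i. i \<in> {1..n} \<Longrightarrow> 0 \<le> p i \<and> p i \<le> 1"
  shows "measure M {\<omega> \<in> space M. (\<Sum>i=1..n. X i \<omega>) \<ge> of_int j} = bernoulli_tail p n j"
  using assms(2-)
proof (induction n arbitrary: j)
  case 0
  interpret prob_space M by fact
  show ?case by (simp add: prob_space)
next
  case (Suc n)
  interpret prob_space M by fact
  let ?S = "\<lambda>\<omega>. \<Sum>i=1..n. X i \<omega>" and ?Z = "X (Suc n)"
  have ins: "{1..Suc n} = insert (Suc n) {1..n}" by auto
  have indep: "indep_var borel ?Z borel ?S"
    using Suc.prems(1) unfolding ins by (intro indep_vars_sum) simp_all
  have Z: "bernoulli_rv M ?Z (p (Suc n))" and p: "0 \<le> p (Suc n)" "p (Suc n) \<le> 1"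
    using Suc.prems(2,3) by simp_all
  have [measurable]: "?Z \<in> borel_measurable M" "?S \<in> borel_measurable M"
    using indep_var_rv1[OF indep] indep_var_rv2[OF indep] by simp_all
  have "(\<lambda>\<omega>. \<Sum>i=1..Suc n. X i \<omega>) = (\<lambda>\<omega>. ?Z \<omega> + ?S \<omega>)" by (simp add: add.commute)
  then have [measurable]: "(\<lambda>\<omega>. \<Sum>i=1..Suc n. X i \<omega>) \<in> borel_measurable M"
    by (simp only:) measurable
  have IH: "measure M {\<omega> \<in> space M. ?S \<omega> \<ge> of_int i} = bernoulli_tail p n i" for i
    using indep_vars_subset[OF Suc.prems(1)] Suc.prems(2,3) by (intro Suc.IH) auto
  have split: "prob {\<omega> \<in> space M. ?Z \<omega> = z \<and> ?S \<omega> \<ge> of_int i}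
      = prob {\<omega> \<in> space M. ?Z \<omega> = z} * bernoulli_tail p n i" for z i
    using prob_indep_random_variable[OF indep, of "{z}" "{of_int i..}"]
    unfolding IH[symmetric] by simp
  \<comment> \<open>The events agree only almost surely, because a variable with a Bernoulli law may
    take other values on a null set.\<close>
  have "AE \<omega> in M. (\<omega> \<in> {\<omega> \<in> space M. (\<Sum>i=1..Suc n. X i \<omega>) \<ge> of_int j})
      = (\<omega> \<in> {\<omega> \<in> space M. ?Z \<omega> = 1 \<and> ?S \<omega> \<ge> of_int (j - 1)}
        \<union> {\<omega> \<in> space M. ?Z \<omega> = 0 \<and> ?S \<omega> \<ge> of_int j})"
    using bernoulli_rv_AE[OF \<open>prob_space M\<close> Z] by eventually_elim auto
  then have "prob {\<omega> \<in> space M. (\<Sum>i=1..Suc n. X i \<omega>) \<ge> of_int j}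
      = prob ({\<omega> \<in> space M. ?Z \<omega> = 1 \<and> ?S \<omega> \<ge> of_int (j - 1)}
        \<union> {\<omega> \<in> space M. ?Z \<omega> = 0 \<and> ?S \<omega> \<ge> of_int j})"
    by (rule measure_eq_AE) measurable
  also have "\<dots> = prob {\<omega> \<in> space M. ?Z \<omega> = 1 \<and> ?S \<omega> \<ge> of_int (j - 1)}
      + prob {\<omega> \<in> space M. ?Z \<omega> = 0 \<and> ?S \<omega> \<ge> of_int j}"
    by (rule finite_measure_Union) (measurable, auto)
  also have "\<dots> = bernoulli_tail p (Suc n) j"
    by (simp only: split bernoulli_rv_prob[OF \<open>prob_space M\<close> Z p] bernoulli_step_def
        bernoulli_tail.simps)
  finally show ?case .
qed

section \<open>Ordered coupling and conditional laws\<close>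

lemma stoch_dom_of_cdf_le:
  fixes \<mu> \<nu> :: "real measure"
  assumes "real_distribution \<mu>" "real_distribution \<nu>" and le: "\<And>x. cdf \<nu> x \<le> cdf \<mu> x"
  shows "\<mu> \<preceq> \<nu>"
proof -
  interpret \<mu>: cdf_distribution \<mu> unfolding cdf_distribution_def by fact
  interpret \<nu>: cdf_distribution \<nu> unfolding cdf_distribution_def by fact
  let ?\<Omega> = "restrict_space lborel {0<..<1::real}"
  interpret \<Omega>: prob_space ?\<Omega>
    by (auto simp: emeasure_restrict_space space_restrict_space intro!: prob_spaceI)
  have [measurable]: "\<mu>.I \<in> borel_measurable ?\<Omega>" "\<nu>.I \<in> borel_measurable ?\<Omega>"
    using \<mu>.measurable_CI \<nu>.measurable_CI
    by (simp_all cong: measurable_cong_sets sets_restrict_space_cong)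
  \<comment> \<open>\<open>I\<close> is the quantile function, and \<open>I u \<le> x\<close> is
    equivalent to \<open>u \<le> cdf x\<close>. With \<open>x = \<nu>.I u\<close>, the bound on the
    distribution functions passes \<open>u \<le> cdf \<nu> x\<close> on to
    \<open>cdf \<mu> x\<close>.\<close>
  have I_le: "\<mu>.I u \<le> \<nu>.I u" if "0 < u" "u < 1" for u
    using \<mu>.pseudoinverse[OF that] \<nu>.pseudoinverse[OF that] le order_trans by blast
  \<comment> \<open>\<open>stoch_dom\<close> fixes the sample space to pairs, so the joint law is
    used, with the two projections as coupled variables.\<close>
  define P where "P = distr ?\<Omega> (borel \<Otimes>\<^sub>M borel) (\<lambda>u. (\<mu>.I u, \<nu>.I u))"
  have "prob_space P"
    unfolding P_def by (intro \<Omega>.prob_space_distr) measurable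
  moreover have "fst \<in> borel_measurable P" "snd \<in> borel_measurable P"
    unfolding P_def by simp_all
  moreover have "distr P borel fst = \<mu>" "distr P borel snd = \<nu>"
    unfolding P_def using \<mu>.distr_I_eq_M \<nu>.distr_I_eq_M
    by (simp_all add: distr_distr comp_def)
  moreover have "AE \<omega> in P. fst \<omega> \<le> snd \<omega>"
    unfolding P_def
    by (subst AE_distr_iff) (auto simp: space_restrict_space I_le intro!: AE_I2)
  ultimately show ?thesis
    unfolding stoch_dom_def by blast
qed

text \<open>For an integer-valued sum, being at least \<open>k\<close> and exceeding
  \<open>x\<close> is a single tail event, so the conditional probability of exceeding
  \<open>x\<close> is a quotient of two tails.\<close>

lemma cond_law_bernoulli_sum:
  fixes X :: "nat \<Rightarrow> 'a \<Rightarrow> real"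
  assumes M: "prob_space M" and indep: "prob_space.indep_vars M (\<lambda>_. borel) X {1..n}"
    and X: "\<And>i. i \<in> {1..n} \<Longrightarrow> bernoulli_rv M (X i) (p i)"
    and p: "\<And>i. i \<in> {1..n} \<Longrightarrow> 0 < p i \<and> p i \<le> 1" and k: "k \<le> n"
  defines "\<mu> \<equiv> cond_law M (\<lambda>\<omega>. \<Sum>i=1..n. X i \<omega>) {\<omega> \<in> space M. (\<Sum>i=1..n. X i \<omega>) \<ge> real k}"
  shows "real_distribution \<mu>"
    and "cdf \<mu> x = 1 - bernoulli_tail p n (max (int k) (\<lfloor>x\<rfloor> + 1)) / bernoulli_tail p n (int k)"
proof -
  interpret prob_space M by fact
  let ?S = "\<lambda>\<omega>. \<Sum>i=1..n. X i \<omega>"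
  let ?A = "{\<omega> \<in> space M. ?S \<omega> \<ge> real k}"
  let ?U = "uniform_measure M ?A"
  have [measurable]: "X i \<in> borel_measurable M" if "i \<in> {1..n}" for i
    using X[OF that] by (simp add: bernoulli_rv_def)
  have S[measurable]: "?S \<in> borel_measurable M" by measurable
  have tail: "prob {\<omega> \<in> space M. ?S \<omega> \<ge> of_int j} = bernoulli_tail p n j" for j
    using prob_bernoulli_sum_ge[OF M indep X, of j] p by (simp add: less_imp_le)
  have A: "prob ?A = bernoulli_tail p n (int k)" using tail[of "int k"] by simp
  \<comment> \<open>Here \<open>k \<le> n\<close> gives the conditioning event positive probability,
    which makes \<open>uniform_measure\<close> a probability measure.\<close>
  have pos: "0 < bernoulli_tail p n (int k)" using k by (intro bernoulli_tail_pos p) simp_all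
  have A0: "emeasure M ?A \<noteq> 0" "emeasure M ?A \<noteq> \<infinity>"
    using A pos by (simp_all add: emeasure_eq_measure)
  interpret U: prob_space ?U using A0 by (rule prob_space_uniform_measure)
  have SU[measurable]: "?S \<in> borel_measurable ?U" using S by simp
  show "real_distribution \<mu>" unfolding \<mu>_def cond_law_def by (rule U.real_distribution_distr[OF SU])
  interpret \<mu>: real_distribution \<mu> by fact
  have int: "AE \<omega> in M. ?S \<omega> \<in> \<int>" using bernoulli_sum_AE_Ints[OF M X] .
  \<comment> \<open>For an integer \<open>m\<close>, \<open>x < m\<close> is equivalent to
    \<open>\<lfloor>x\<rfloor> + 1 \<le> m\<close>; the maximum merges this with
    \<open>k \<le> m\<close>.\<close>
  have "AE \<omega> in M. (\<omega> \<in> ?A \<inter> {\<omega> \<in> space M. x < ?S \<omega>})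
      = (\<omega> \<in> {\<omega> \<in> space M. ?S \<omega> \<ge> of_int (max (int k) (\<lfloor>x\<rfloor> + 1))})"
    using int
  proof eventually_elim
    case (elim \<omega>)
    then obtain m where "?S \<omega> = of_int m" by (auto elim: Ints_cases)
    then show ?case by (auto simp: floor_less_iff[symmetric] le_floor_iff[symmetric])
  qed
  then have "prob (?A \<inter> {\<omega> \<in> space M. x < ?S \<omega>})
      = prob {\<omega> \<in> space M. ?S \<omega> \<ge> of_int (max (int k) (\<lfloor>x\<rfloor> + 1))}"
    by (rule measure_eq_AE) measurable
  also have "\<dots> = bernoulli_tail p n (max (int k) (\<lfloor>x\<rfloor> + 1))" by (rule tail)
  finally have eq: "prob (?A \<inter> {\<omega> \<in> space M. x < ?S \<omega>}) = \<dots>" .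
  have "measure \<mu> {x<..} = measure ?U {\<omega> \<in> space M. x < ?S \<omega>}"
    unfolding \<mu>_def cond_law_def
    by (subst measure_distr) (auto simp: vimage_def Int_def conj_commute)
  also have "\<dots> = bernoulli_tail p n (max (int k) (\<lfloor>x\<rfloor> + 1)) / bernoulli_tail p n (int k)"
    by (subst measure_uniform_measure[OF A0]) (simp_all only: eq A, measurable)
  finally have "measure \<mu> {x<..} = \<dots>" .
  moreover have "{x<..} = space \<mu> - {..x}" by auto
  ultimately show "cdf \<mu> x = 1 - bernoulli_tail p n (max (int k) (\<lfloor>x\<rfloor> + 1)) / bernoulli_tail p n (int k)"
    using \<mu>.prob_compl[of "{..x}"] by (simp add: cdf_def)
qed

theorem proposition1p1:
  fixes M :: "'a measure" and N :: "'b measure"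
    and X :: "nat \<Rightarrow> 'a \<Rightarrow> real" and Y :: "nat \<Rightarrow> 'b \<Rightarrow> real"
    and p q :: "nat \<Rightarrow> real" and n k :: nat
  assumes "prob_space M" and "prob_space N"
    and "prob_space.indep_vars M (\<lambda>_. borel) X {1..n}"
    and "prob_space.indep_vars N (\<lambda>_. borel) Y {1..n}"
    and "\<And>i. i \<in> {1..n} \<Longrightarrow> bernoulli_rv M (X i) (p i)"
    and "\<And>i. i \<in> {1..n} \<Longrightarrow> bernoulli_rv N (Y i) (q i)"
    and "\<And>i. i \<in> {1..n} \<Longrightarrow> 0 < p i \<and> p i \<le> q i \<and> q i < 1"
    and "k \<in> {0..n}"
  shows "cond_law M (\<lambda>\<omega>. \<Sum>i=1..n. X i \<omega>) {\<omega> \<in> space M. (\<Sum>i=1..n. X i \<omega>) \<ge> real k}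
       \<preceq> cond_law N (\<lambda>\<omega>. \<Sum>i=1..n. Y i \<omega>) {\<omega> \<in> space N. (\<Sum>i=1..n. Y i \<omega>) \<ge> real k}"
proof (rule stoch_dom_of_cdf_le)
  have p: "0 < p i \<and> p i \<le> 1" and q: "0 < q i \<and> q i \<le> 1" if "i \<in> {1..n}" for i
    using assms(7)[OF that] by simp_all
  have k: "k \<le> n" using assms(8) by simp
  let ?\<mu> = "cond_law M (\<lambda>\<omega>. \<Sum>i=1..n. X i \<omega>) {\<omega> \<in> space M. (\<Sum>i=1..n. X i \<omega>) \<ge> real k}"
  let ?\<nu> = "cond_law N (\<lambda>\<omega>. \<Sum>i=1..n. Y i \<omega>) {\<omega> \<in> space N. (\<Sum>i=1..n. Y i \<omega>) \<ge> real k}"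
  show "real_distribution ?\<mu>" by (rule cond_law_bernoulli_sum(1)[OF assms(1,3,5) p k])
  show "real_distribution ?\<nu>" by (rule cond_law_bernoulli_sum(1)[OF assms(2,4,6) q k])
  fix x :: real
  \<comment> \<open>This index depends only on \<open>k\<close> and \<open>x\<close>, so both laws
    share it, and the maximum ensures \<open>k \<le> ?j\<close>, as the ratio order
    requires.\<close>
  let ?j = "max (int k) (\<lfloor>x\<rfloor> + 1)"
  have cdf_\<mu>: "cdf ?\<mu> x = 1 - bernoulli_tail p n ?j / bernoulli_tail p n (int k)"
    by (rule cond_law_bernoulli_sum(2)[OF assms(1,3,5) p k])
  have cdf_\<nu>: "cdf ?\<nu> x = 1 - bernoulli_tail q n ?j / bernoulli_tail q n (int k)"
    by (rule cond_law_bernoulli_sum(2)[OF assms(2,4,6) q k])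
  have pos: "0 < bernoulli_tail p n (int k)" "0 < bernoulli_tail q n (int k)"
    using k bernoulli_tail_pos[OF p] bernoulli_tail_pos[OF q] by simp_all
  have "ratio_le (bernoulli_tail p n) (bernoulli_tail q n)"
    using assms(7) by (intro ratio_le_bernoulli_tail) (simp add: less_imp_le)
  then have "bernoulli_tail p n ?j * bernoulli_tail q n (int k)
      \<le> bernoulli_tail q n ?j * bernoulli_tail p n (int k)"
    by (rule ratio_leD) simp
  then have "bernoulli_tail p n ?j / bernoulli_tail p n (int k)
      \<le> bernoulli_tail q n ?j / bernoulli_tail q n (int k)"
    using pos by (simp add: field_simps)
  then show "cdf ?\<nu> x \<le> cdf ?\<mu> x"
    unfolding cdf_\<mu> cdf_\<nu> by simp
qed

end
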